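(* Let $\widetilde f,\widetilde g$ be generalized densities on $\mathbb{R}$ and let $\widetilde h=\widetilde g\ast\widetilde f\in\mathcal{S}$, where $\widetilde g(x)=p_g\delta(x)+(1-p_g)g(x)$ with $p_g\in(2^{-1},1)$ and $g$ a probability density. Suppose that $\widetilde h$ is almost decreasing (al.d.) or that $\widetilde f(x)=p_f\delta(x)+(1-p_f)f(x)$ with $p_f\in(0,1)$ and $f$ a probability density. Then $\widetilde g(x)=o(\widetilde h(x))$ as $x\to\infty$ implies $\widetilde f\in\mathcal{S}$, and indeed $\widetilde h(x)\sim\widetilde f(x)$.
   Context: A generalized density is $\widetilde f(x)=p\,\delta(x)+q f(x)$ with $p+q=1$, $p,q\ge0$, where $f$ is an (ordinary) probability density on $\mathbb{R}$ and $\delta$ is the Dirac delta at $0$; it represents the measure $p\delta_0(dx)+qf(x)dx$. For $x\ne0$ its value is $qf(x)$. Convolutions are convolutions of measures, e.g. $\widetilde g\ast\widetilde f=p_gp_f\delta+p_g(1-p_f)f+(1-p_g)p_fg+(1-p_g)(1-p_f)f\ast g$. The tail definitions below are applied to generalized densities through their values at $x\neq0$. $\alpha(x)\sim\beta(x)$ means $\alpha(x)/\beta(x)\to1$ as $x\to\infty$. A (generalized) density $k$: - is long-tailed, $k\in\mathcal{L}$, if there is $x_0>0$ with $k(x)>0$ for $x\ge x_0$ and, for each fixed $y>0$, $k(x+y)\sim k(x)$; - is subexponential, $k\in\mathcal{S}$, if $k\in\mathcal{L}$ and $k^{\ast2}(x)\sim2k(x)$; - is al.d. if there are $x_0>0$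 and $K>0$ such that $k(x+y)\le Kk(x)$ for all $x>x_0$, $y>0$. *)

theory Defs
  imports "HOL-Probability.Probability"
begin

text \<open>
  Densities take values in \<open>[0,\<infinity>]\<close>, because the pointwise convolution of two everywhere finite
  densities may be infinite on a null set, and the tail conditions below are pointwise conditions.
\<close>

definition prob_density :: "(real \<Rightarrow> ennreal) \<Rightarrow> bool" where
  "prob_density f \<longleftrightarrow> f \<in> borel_measurable borel \<and> (\<integral>\<^sup>+x. f x \<partial>lborel) = 1"

text \<open>
  A generalized density \<open>p \<delta> + q f\<close> is stored as the mass \<open>p\<close> of its atom at \<open>0\<close> together with its
  absolutely continuous part \<open>q f\<close>; the latter is its value at \<open>x \<noteq> 0\<close>, the only values that the
  tail conditions see.
\<close>

datatype gdens = GDens (atom: ennreal) (acpart: "real \<Rightarrow> ennreal")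

definition mix :: "real \<Rightarrow> (real \<Rightarrow> ennreal) \<Rightarrow> gdens" where
  "mix p f = GDens (ennreal p) (\<lambda>x. ennreal (1 - p) * f x)"

definition gen_density :: "gdens \<Rightarrow> bool" where
  "gen_density k \<longleftrightarrow> (\<exists>p f. 0 \<le> p \<and> p \<le> 1 \<and> prob_density f \<and> k = mix p f)"

definition gmeasure :: "gdens \<Rightarrow> real measure" where
  "gmeasure k = measure_of UNIV (sets borel)
     (\<lambda>A. atom k * emeasure (return borel 0) A + emeasure (density lborel (acpart k)) A)"

definition gconv :: "gdens \<Rightarrow> gdens \<Rightarrow> gdens" (infixl "\<star>\<^sub>g" 70) where
  "k \<star>\<^sub>g l = GDens (atom k * atom l)
     (\<lambda>x. atom k * acpart l x + atom l * acpart k x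
            + (\<integral>\<^sup>+y. acpart k (x - y) * acpart l y \<partial>lborel))"

text \<open>
  In \<^typ>\<open>ennreal\<close>, \<open>a / \<infinity> = 0\<close> (also for \<open>a = \<infinity>\<close>) and \<open>a / 0 \<in> {0, \<infinity>}\<close>, so the ratio below
  can only tend to \<open>1\<close> if both functions are eventually positive and finite.
\<close>

definition tail_equiv :: "(real \<Rightarrow> ennreal) \<Rightarrow> (real \<Rightarrow> ennreal) \<Rightarrow> bool" (infix "\<sim>\<^sub>t" 50) where
  "\<alpha> \<sim>\<^sub>t \<beta> \<longleftrightarrow> ((\<lambda>x. \<alpha> x / \<beta> x) \<longlongrightarrow> 1) at_top"

definition tail_smallo :: "(real \<Rightarrow> ennreal) \<Rightarrow> (real \<Rightarrow> ennreal) \<Rightarrow> bool" where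
  "tail_smallo \<alpha> \<beta> \<longleftrightarrow> ((\<lambda>x. \<alpha> x / \<beta> x) \<longlongrightarrow> 0) at_top"

definition long_tailed :: "gdens \<Rightarrow> bool" where
  "long_tailed k \<longleftrightarrow> (\<exists>x\<^sub>0>0. \<forall>x\<ge>x\<^sub>0. acpart k x > 0) \<and>
     (\<forall>y>0. (\<lambda>x. acpart k (x + y)) \<sim>\<^sub>t acpart k)"

definition subexponential :: "gdens \<Rightarrow> bool" where
  "subexponential k \<longleftrightarrow> long_tailed k \<and> acpart (k \<star>\<^sub>g k) \<sim>\<^sub>t (\<lambda>x. 2 * acpart k x)"

definition almost_decreasing :: "gdens \<Rightarrow> bool" where
  "almost_decreasing k \<longleftrightarrow> (\<exists>x\<^sub>0>0. \<exists>K>0::real. \<forall>x>x\<^sub>0. \<forall>y>0.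
     acpart k (x + y) \<le> ennreal K * acpart k x)"

text \<open>
  The operation \<^const>\<open>gconv\<close> is the convolution of the represented measures, and it
  preserves generalized densities.
\<close>

lemma sets_gmeasure [simp, measurable_cong]: "sets (gmeasure k) = sets borel"
  and space_gmeasure [simp]: "space (gmeasure k) = UNIV"
  unfolding gmeasure_def
  by (simp_all, metis sets.sigma_sets_eq space_borel)

lemma emeasure_gmeasure:
  assumes "A \<in> sets borel"
  shows "emeasure (gmeasure k) A =
    atom k * emeasure (return borel 0) A + emeasure (density lborel (acpart k)) A"
proof (rule emeasure_measure_of[OF gmeasure_def])
  let ?\<mu> = "\<lambda>A. atom k * emeasure (return borel (0::real)) A
                  + emeasure (density lborel (acpart k)) A"
  show "countably_additive (sets (gmeasure k)) ?\<mu>"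
  proof (rule countably_additiveI)
    fix B :: "nat \<Rightarrow> real set"
    assume B: "range B \<subseteq> sets (gmeasure k)" "disjoint_family B"
    have "(\<Sum>i. ?\<mu> (B i)) = atom k * (\<Sum>i. emeasure (return borel 0) (B i))
        + (\<Sum>i. emeasure (density lborel (acpart k)) (B i))"
      by (simp add: suminf_add[symmetric])
    also have "\<dots> = ?\<mu> (\<Union>i. B i)"
      using B by (subst (1 2) suminf_emeasure) auto
    finally show "(\<Sum>i. ?\<mu> (B i)) = ?\<mu> (\<Union>i. B i)" .
  qed
qed (use assms in \<open>auto simp: positive_def\<close>)

lemma nn_integral_gmeasure:
  assumes a: "acpart k \<in> borel_measurable borel" and \<phi>: "\<phi> \<in> borel_measurable borel"
  shows "(\<integral>\<^sup>+x. \<phi> x \<partial>gmeasure k) = atom k * \<phi> 0 + (\<integral>\<^sup>+x. acpart k x * \<phi> x \<partial>lborel)"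
  using \<phi>
proof (induction rule: borel_measurable_induct)
  case (cong f g)
  then show ?case by (simp cong: nn_integral_cong)
next
  case (set A)
  then show ?case using a by (simp add: emeasure_gmeasure emeasure_density)
next
  case (mult u c)
  then show ?case using a
    by (simp add: nn_integral_cmult ring_distribs mult.left_commute[of _ c])
next
  case (add u v)
  then show ?case using a
    by (simp add: nn_integral_add ring_distribs ac_simps)
next
  case (seq U)
  then have [measurable]: "U i \<in> borel_measurable borel" for i by simp
  have "(\<integral>\<^sup>+x. (SUP i. U i) x \<partial>gmeasure k) = (SUP i. \<integral>\<^sup>+x. U i x \<partial>gmeasure k)"
    unfolding SUP_apply by (rule nn_integral_monotone_convergence_SUP) (use seq in auto)
  also have "\<dots> = (SUP i. atom k * U i 0 + (\<integral>\<^sup>+x. acpart k x * U i x \<partial>lborel))"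
    using seq by simp
  also have "\<dots> = (SUP i. atom k * U i 0) + (SUP i. \<integral>\<^sup>+x. acpart k x * U i x \<partial>lborel)"
    using seq(3)
    by (intro ennreal_SUP_add) (auto simp: incseq_def le_fun_def intro!: mult_left_mono nn_integral_mono)
  also have "(SUP i. \<integral>\<^sup>+x. acpart k x * U i x \<partial>lborel)
      = (\<integral>\<^sup>+x. (SUP i. acpart k x * U i x) \<partial>lborel)"
    using seq(3) a
    by (intro nn_integral_monotone_convergence_SUP[symmetric])
       (auto simp: incseq_def le_fun_def intro!: mult_left_mono)
  finally show ?case by (simp add: SUP_apply SUP_mult_left_ennreal image_image)
qed

lemma gen_density_gmeasure:
  assumes "gen_density k"
  shows "acpart k \<in> borel_measurable borel" "prob_space (gmeasure k)"
proof -
  obtain p f where p: "0 \<le> p" "p \<le> 1" and f: "f \<in> borel_measurable borel"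
    "(\<integral>\<^sup>+x. f x \<partial>lborel) = 1" and k: "k = mix p f"
    using assms unfolding gen_density_def prob_density_def by auto
  show m: "acpart k \<in> borel_measurable borel" using f k by (simp add: mix_def)
  have "emeasure (gmeasure k) UNIV = ennreal p + ennreal (1 - p)"
    using f m k by (simp add: emeasure_gmeasure emeasure_density mix_def nn_integral_cmult)
  also have "\<dots> = 1" using p by (simp flip: ennreal_plus)
  finally show "prob_space (gmeasure k)" by (intro prob_spaceI) simp
qed

lemma gmeasure_gconv:
  assumes k: "gen_density k" and l: "gen_density l"
  shows "gmeasure (k \<star>\<^sub>g l) = (gmeasure k \<star> gmeasure l)"
proof (rule measure_eqI)
  note [measurable] = gen_density_gmeasure(1)[OF k] gen_density_gmeasure(1)[OF l]
  interpret K: prob_space "gmeasure k" by (rule gen_density_gmeasure[OF k])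
  interpret L: prob_space "gmeasure l" by (rule gen_density_gmeasure[OF l])
  show "sets (gmeasure (k \<star>\<^sub>g l)) = sets (gmeasure k \<star> gmeasure l)" by simp
  fix A assume "A \<in> sets (gmeasure (k \<star>\<^sub>g l))"
  then have A [measurable]: "A \<in> sets borel" by simp
  let ?a = "acpart k" and ?b = "acpart l" and ?I = "indicator A :: real \<Rightarrow> ennreal"
  have c: "(\<integral>\<^sup>+z. ?a x * ?b z * ?I (x + z) \<partial>lborel) = (\<integral>\<^sup>+z. ?a x * ?b (z - x) * ?I z \<partial>lborel)" for x
    by (subst nn_integral_real_affine[where c=1 and t="-x"]) (auto simp: algebra_simps)
  have s: "(\<integral>\<^sup>+y. ?a (z - y) * ?b y \<partial>lborel) = (\<integral>\<^sup>+x. ?a x * ?b (z - x) \<partial>lborel)" for z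
    by (subst nn_integral_real_affine[where c="-1" and t=z]) auto
  have "(\<integral>\<^sup>+x. ?a x * (\<integral>\<^sup>+z. ?b z * ?I (x + z) \<partial>lborel) \<partial>lborel)
      = (\<integral>\<^sup>+x. (\<integral>\<^sup>+z. ?a x * ?b (z - x) * ?I z \<partial>lborel) \<partial>lborel)"
    unfolding c[symmetric] by (simp add: nn_integral_cmult mult.assoc)
  also have "\<dots> = (\<integral>\<^sup>+z. (\<integral>\<^sup>+x. ?a x * ?b (z - x) * ?I z \<partial>lborel) \<partial>lborel)"
    by (rule lborel_pair.Fubini') simp
  also have "\<dots> = (\<integral>\<^sup>+z. (\<integral>\<^sup>+y. ?a (z - y) * ?b y \<partial>lborel) * ?I z \<partial>lborel)"
    unfolding s by (simp add: nn_integral_multc)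
  finally have conv: "(\<integral>\<^sup>+x. ?a x * (\<integral>\<^sup>+z. ?b z * ?I (x + z) \<partial>lborel) \<partial>lborel) = \<dots>" .
  have em: "emeasure (gmeasure l) {y. y + x \<in> A} = atom l * ?I x + (\<integral>\<^sup>+z. ?b z * ?I (x + z) \<partial>lborel)" for x
  proof -
    have [measurable]: "{y. y + x \<in> A} \<in> sets borel" by measurable
    show ?thesis
      by (simp add: emeasure_gmeasure emeasure_density indicator_def add.commute)
  qed
  have "emeasure (gmeasure k \<star> gmeasure l) A
      = (\<integral>\<^sup>+x. emeasure (gmeasure l) {y. y + x \<in> A} \<partial>gmeasure k)"
    by (rule convolution_emeasure) (auto intro: K.finite_measure_axioms L.finite_measure_axioms)
  also have "\<dots> = atom k * (atom l * ?I 0 + (\<integral>\<^sup>+z. ?b z * ?I z \<partial>lborel))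
      + (\<integral>\<^sup>+x. ?a x * (atom l * ?I x + (\<integral>\<^sup>+z. ?b z * ?I (x + z) \<partial>lborel)) \<partial>lborel)"
    unfolding em by (subst nn_integral_gmeasure) auto
  also have "\<dots> = emeasure (gmeasure (k \<star>\<^sub>g l)) A"
    using A conv
    by (simp add: emeasure_gmeasure gconv_def emeasure_density ring_distribs nn_integral_add
        nn_integral_cmult mult.assoc mult.left_commute[of _ "atom l"] add.assoc)
  finally show "emeasure (gmeasure (k \<star>\<^sub>g l)) A = emeasure (gmeasure k \<star> gmeasure l) A" by simp
qed

lemma gen_density_gconv:
  assumes k: "gen_density k" and l: "gen_density l"
  shows "gen_density (k \<star>\<^sub>g l)"
proof -
  obtain p f r g where p: "0 \<le> p" "p \<le> 1" and r: "0 \<le> r" "r \<le> 1"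
    and f: "prob_density f" and g: "prob_density g" and kl: "k = mix p f" "l = mix r g"
    using k l unfolding gen_density_def by blast
  note [measurable] = gen_density_gmeasure(1)[OF k] gen_density_gmeasure(1)[OF l]
  have pr: "0 \<le> p * r" "p * r \<le> 1" using p r by (auto intro: mult_le_one)
  have at: "atom (k \<star>\<^sub>g l) = ennreal (p * r)"
    using p r by (simp add: gconv_def kl mix_def ennreal_mult)
  have m [measurable]: "acpart (k \<star>\<^sub>g l) \<in> borel_measurable borel"
    unfolding gconv_def gdens.sel by measurable
  interpret K: prob_space "gmeasure k" by (rule gen_density_gmeasure[OF k])
  interpret L: prob_space "gmeasure l" by (rule gen_density_gmeasure[OF l])
  have "emeasure (gmeasure (k \<star>\<^sub>g l)) UNIV = emeasure (gmeasure k) UNIV"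
    unfolding gmeasure_gconv[OF k l]
    using L.emeasure_space_1
    by (subst convolution_emeasure)
       (auto intro: K.finite_measure_axioms L.finite_measure_axioms)
  then have tot: "ennreal (p * r) + (\<integral>\<^sup>+x. acpart (k \<star>\<^sub>g l) x \<partial>lborel) = 1"
    using K.emeasure_space_1 by (simp add: emeasure_gmeasure emeasure_density at)
  show ?thesis
  proof (cases "p * r = 1")
    case True
    then have "p = 1" "r = 1" using p r mult_left_le[of r p] mult_right_le_one_le[of r p] by auto
    then have "k \<star>\<^sub>g l = mix 1 f" by (simp add: gconv_def kl mix_def)
    then show ?thesis
      using f unfolding gen_density_def by (intro exI[of _ "1::real"] exI[of _ f]) auto
  next
    case False
    with pr have lt: "p * r < 1" by simp
    define u where "u x = ennreal (1 / (1 - p * r)) * acpart (k \<star>\<^sub>g l) x" for x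
    have one: "ennreal (1 - p * r) * ennreal (1 / (1 - p * r)) = 1"
      using lt by (simp flip: ennreal_mult)
    have "ennreal (1 - p * r) = 1 - ennreal (p * r)"
      using pr by (simp add: ennreal_minus flip: ennreal_1)
    also have "\<dots> = (\<integral>\<^sup>+x. acpart (k \<star>\<^sub>g l) x \<partial>lborel)"
      unfolding tot[symmetric] by (simp add: ennreal_add_diff_cancel_left)
    finally have "(\<integral>\<^sup>+x. u x \<partial>lborel) = 1"
      using one by (simp add: u_def nn_integral_cmult mult.commute[of "ennreal (1 / (1 - p * r))"] nn_integral_multc)
    then have "prob_density u" by (simp add: prob_density_def u_def[abs_def])
    moreover have "k \<star>\<^sub>g l = mix (p * r) u"
      using one at by (intro gdens.expand) (simp add: mix_def u_def fun_eq_iff flip: mult.assoc)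
    ultimately show ?thesis using pr unfolding gen_density_def by blast
  qed
qed

end

theory Submission
  imports Defs
begin

text \<open>
  Write \<open>a\<close>, \<open>b\<close>, \<open>h\<close> for the absolutely continuous parts of \<open>G\<close>, \<open>F\<close>, \<open>H\<close>, let \<open>p\<close> be the atom of
  \<open>G\<close>, \<open>q = 1 - p\<close> the mass of \<open>a\<close>, and \<open>c\<close> the atom of \<open>F\<close>. Splitting the convolution integral at
  \<open>x / 2\<close>, put \<open>[w, v](x) = \<integral>\<^bsub>y \<le> x / 2\<^esub> w(y) v(x - y) dy\<close>. Then the hypothesis \<open>H = G \<star> F\<close> reads
  \<open>h = p b + c a + [b, a] + [a, b]\<close>, and \<open>H\<close> is subexponential iff it is long-tailed and
  \<open>[h, h](x) / h(x) \<rightarrow> \<integral> h\<close>.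

  For a long-tailed \<open>h\<close> the kernel \<open>1\<^bsub>y \<le> x / 2\<^esub> h(x - y) / h(x)\<close> tends to \<open>1\<close> for each \<open>y\<close>. By
  subexponentiality its integral against \<open>h(y) dy\<close> converges to the integral of the limit, so by
  Fatou's lemma the same holds for every weight \<open>w\<close> dominated by a multiple of \<open>h\<close>:
  \<open>[w, h] / h \<rightarrow> \<integral> w\<close> (\<open>half_conv_ratio_dominated\<close>). This applies to \<open>w = b\<close>, since \<open>p b \<le> h\<close>, and
  to \<open>w = a\<close> if \<open>c > 0\<close>, since \<open>c a \<le> h\<close>. If instead \<open>h\<close> is almost decreasing, then
  \<open>a = o(h)\<close> gives \<open>a \<le> h\<close> far to the right, while on the remaining left half-line the kernel is
  bounded for large \<open>x\<close> and dominated convergence applies (\<open>half_conv_ratio_al_decreasing\<close>). In both cases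
  \<open>[a, h] / h \<rightarrow> q\<close> and \<open>[b, h] / h \<rightarrow> 1 - c\<close>.

  On \<open>y \<le> x / 2\<close> the argument \<open>x - y \<ge> x / 2\<close> is large, so \<open>h\<close> may be replaced by any \<open>v\<close> with
  \<open>v / h\<close> convergent (\<open>half_conv_ratio_transfer\<close>). Hence \<open>[b, a] = o(h)\<close>, and \<open>\<beta> = b / h\<close>
  satisfies \<open>p \<beta> + [a, b] / h + o(1) = 1\<close>. If \<open>\<bar>\<beta> - 1\<bar> \<le> d\<close> eventually, then
  \<open>[a, b] / h\<close> differs from \<open>q\<close> by at most \<open>q d + o(1)\<close>, so \<open>\<bar>\<beta> - 1\<bar> \<le> (q / p) d + o(1)\<close>. Since
  \<open>q < p\<close>, iterating gives \<open>\<beta> \<rightarrow> 1\<close> (\<open>tail_equiv_of_renewal_equation\<close>). Finally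
  \<open>[b, b] / h \<rightarrow> 1 - c\<close> by another replacement of \<open>h\<close> by \<open>b\<close>, so \<open>F\<close> is subexponential.
\<close>

section \<open>Tail equivalence\<close>

text \<open>
  Since \<open>x / \<infinity> = 0\<close> and \<open>x / 0 \<in> {0, \<infinity>}\<close>, a ratio with limit \<open>1\<close> has an eventually finite and positive
  numerator and denominator.
\<close>

lemma tail_equiv_eventually_finite:
  assumes "f \<sim>\<^sub>t g"
  shows "\<forall>\<^sub>F x in at_top. 0 < f x \<and> f x < top \<and> 0 < g x \<and> g x < top"
proof -
  have lim: "((\<lambda>x. f x / g x) \<longlongrightarrow> 1) at_top" using assms by (simp add: tail_equiv_def)
  show ?thesis
    using order_tendstoD(1)[OF lim, of 0, OF zero_less_one]
      order_tendstoD(2)[OF lim, of top, OF ennreal_one_less_top]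
  proof eventually_elim
    case (elim x)
    then have "0 < f x" "g x < top" by (auto simp: ennreal_zero_less_divide)
    moreover have "g x \<noteq> 0" using elim by (cases "f x = 0") auto
    moreover have "f x \<noteq> top" using elim(2) \<open>g x < top\<close> by (auto simp: ennreal_top_divide split: if_splits)
    ultimately show ?case by (auto simp: less_top zero_less_iff_neq_zero)
  qed
qed

lemma ennreal_ratio_mult_cancel:
  fixes a b c :: ennreal
  assumes "0 < b" "b < top"
  shows "(a / b) * (b / c) = a / c"
proof -
  have "(a / b) * (b / c) = (a * inverse c) * b / b"
    by (simp add: divide_ennreal_def ac_simps)
  then show ?thesis
    using assms by (simp add: mult_divide_eq_ennreal) (simp add: divide_ennreal_def)
qed

lemma tail_equiv_sym:
  assumes "f \<sim>\<^sub>t g"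
  shows "g \<sim>\<^sub>t f"
proof -
  have lim: "((\<lambda>x. f x / g x) \<longlongrightarrow> 1) at_top" using assms by (simp add: tail_equiv_def)
  have "((\<lambda>x. inverse (f x / g x)) \<longlongrightarrow> inverse 1) at_top"
    using continuous_on_tendsto_compose[OF continuous_on_inverse_ennreal[OF continuous_on_id[of UNIV]] lim]
    by simp
  moreover have "\<forall>\<^sub>F x in at_top. inverse (f x / g x) = g x / f x"
    using tail_equiv_eventually_finite[OF assms]
  proof eventually_elim
    case (elim x)
    then show ?case
      by (cases "f x"; cases "g x") (auto simp: divide_ennreal inverse_ennreal)
  qed
  ultimately show ?thesis by (simp add: tail_equiv_def tendsto_cong)
qed

lemma tail_ratio_trans:
  assumes fg: "((\<lambda>x. f x / g x) \<longlongrightarrow> a) at_top" and gk: "g \<sim>\<^sub>t k"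
  shows "((\<lambda>x. f x / k x) \<longlongrightarrow> (a::ennreal)) at_top"
proof -
  have "((\<lambda>x. (f x / g x) * (g x / k x)) \<longlongrightarrow> a * 1) at_top"
    using fg gk unfolding tail_equiv_def by (intro tendsto_mult_ennreal) auto
  moreover have "\<forall>\<^sub>F x in at_top. (f x / g x) * (g x / k x) = f x / k x"
    using tail_equiv_eventually_finite[OF gk]
    by eventually_elim (auto intro: ennreal_ratio_mult_cancel)
  ultimately show ?thesis by (simp add: tendsto_cong)
qed

lemma filterlim_minus_const_at_top: "filterlim (\<lambda>x::real. x - y) at_top at_top"
  using filterlim_tendsto_add_at_top[OF tendsto_const[of "- y"] filterlim_ident] by simp

text \<open>
  Long-tailedness, stated for arguments \<open>x + y\<close> with \<open>y > 0\<close>, extends to shifts of either sign.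
\<close>

lemma tail_equiv_shift:
  assumes lt: "\<And>y. 0 < y \<Longrightarrow> (\<lambda>x. h (x + y)) \<sim>\<^sub>t h"
  shows "(\<lambda>x. h (x - y)) \<sim>\<^sub>t h"
proof -
  consider "y < 0" | "y = 0" | "y > 0" by linarith
  then show ?thesis
  proof cases
    case 1
    with lt[of "- y"] show ?thesis by simp
  next
    case 2
    have "\<forall>\<^sub>F x in at_top. h (x - y) / h x = 1"
      using tail_equiv_eventually_finite[OF lt[OF zero_less_one]]
      by eventually_elim (use 2 in auto)
    then show ?thesis unfolding tail_equiv_def by (rule tendsto_eventually)
  next
    case 3
    have "h \<sim>\<^sub>t (\<lambda>x. h (x - y))"
      using filterlim_compose[OF lt[OF 3, unfolded tail_equiv_def] filterlim_minus_const_at_top[of y]]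
      by (simp add: tail_equiv_def)
    then show ?thesis by (rule tail_equiv_sym)
  qed
qed

lemma long_tailed_tail_equiv:
  assumes lt: "long_tailed k" and eq: "acpart l \<sim>\<^sub>t acpart k"
  shows "long_tailed l"
  unfolding long_tailed_def
proof (intro conjI allI impI)
  obtain N where "\<And>x. x \<ge> N \<Longrightarrow> 0 < acpart l x"
    using tail_equiv_eventually_finite[OF eq] by (auto simp: eventually_at_top_linorder)
  then show "\<exists>x\<^sub>0>0. \<forall>x\<ge>x\<^sub>0. acpart l x > 0"
    by (intro exI[of _ "max 1 N"]) auto
next
  fix y :: real assume "0 < y"
  then have 1: "(\<lambda>x. acpart k (x + y)) \<sim>\<^sub>t acpart k" using lt by (simp add: long_tailed_def)
  have 2: "((\<lambda>x. acpart l (x + y) / acpart k (x + y)) \<longlongrightarrow> 1) at_top"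
    using filterlim_compose[OF eq[unfolded tail_equiv_def] filterlim_minus_const_at_top[of "- y"]]
    by simp
  show "(\<lambda>x. acpart l (x + y)) \<sim>\<^sub>t acpart l"
    using tail_ratio_trans[OF tail_ratio_trans[OF 2 1] tail_equiv_sym[OF eq]]
    by (simp add: tail_equiv_def)
qed

section \<open>Convolution over a half-line\<close>

text \<open>
  The contribution of \<open>y \<le> x / 2\<close> to the convolution \<open>\<integral> w(y) v(x - y) dy\<close>. The weight \<open>w\<close> is seen
  on all of \<open>(-\<infinity>, x / 2]\<close>, the function \<open>v\<close> only on \<open>[x / 2, \<infinity>)\<close>.
\<close>

definition half_conv :: "(real \<Rightarrow> ennreal) \<Rightarrow> (real \<Rightarrow> ennreal) \<Rightarrow> real \<Rightarrow> ennreal" where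
  "half_conv w v x = (\<integral>\<^sup>+y. indicator {..x / 2} y * (w y * v (x - y)) \<partial>lborel)"

lemma convolution_eq_half_conv:
  assumes [measurable]: "k \<in> borel_measurable borel" "l \<in> borel_measurable borel"
  shows "(\<integral>\<^sup>+y. k (x - y) * l y \<partial>lborel) = half_conv l k x + half_conv k l x"
proof -
  have "half_conv k l x = (\<integral>\<^sup>+y. indicator {..x / 2} (x - y) * (k (x - y) * l y) \<partial>lborel)"
    unfolding half_conv_def by (subst nn_integral_real_affine[where c="-1" and t=x]) auto
  also have "\<dots> = (\<integral>\<^sup>+y. indicator {x / 2<..} y * (k (x - y) * l y) \<partial>lborel)"
    by (intro nn_integral_cong_AE eventually_mono[OF AE_lborel_singleton[of "x / 2"]])
       (auto simp: indicator_def field_simps)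
  finally have "half_conv l k x + half_conv k l x =
      (\<integral>\<^sup>+y. indicator {..x / 2} y * (k (x - y) * l y) + indicator {x / 2<..} y * (k (x - y) * l y) \<partial>lborel)"
    unfolding half_conv_def by (simp add: nn_integral_add mult.commute[of "l _"])
  also have "\<dots> = (\<integral>\<^sup>+y. k (x - y) * l y \<partial>lborel)"
    by (intro nn_integral_cong) (auto simp: indicator_def)
  finally show ?thesis by simp
qed

lemma half_conv_divide:
  assumes [measurable]: "w \<in> borel_measurable borel" "v \<in> borel_measurable borel"
  shows "half_conv w v x / c = (\<integral>\<^sup>+y. w y * (indicator {..x / 2} y * (v (x - y) / c)) \<partial>lborel)"
  unfolding half_conv_def
  by (subst nn_integral_divide[symmetric])
     (auto intro!: nn_integral_cong simp: divide_ennreal_def ac_simps)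

lemma half_conv_add:
  assumes [measurable]: "w \<in> borel_measurable borel" "w' \<in> borel_measurable borel"
    "v \<in> borel_measurable borel"
  shows "half_conv (\<lambda>y. w y + w' y) v x = half_conv w v x + half_conv w' v x"
  unfolding half_conv_def by (subst nn_integral_add[symmetric]) (auto simp: algebra_simps)

lemma half_conv_cmult_left:
  assumes [measurable]: "w \<in> borel_measurable borel" "v \<in> borel_measurable borel"
  shows "half_conv (\<lambda>y. c * w y) v x = c * half_conv w v x"
  unfolding half_conv_def by (subst nn_integral_cmult[symmetric]) (auto simp: ac_simps)

lemma half_conv_cmult_right:
  assumes [measurable]: "w \<in> borel_measurable borel" "v \<in> borel_measurable borel"
  shows "half_conv w (\<lambda>y. c * v y) x = c * half_conv w v x"
  unfolding half_conv_def by (subst nn_integral_cmult[symmetric]) (auto simp: ac_simps)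

text \<open>
  Only the tail of the second argument matters: on \<open>y \<le> x / 2\<close> the argument \<open>x - y\<close> is at least \<open>x / 2\<close>.
\<close>

lemma eventually_half_conv_mono:
  assumes "\<forall>\<^sub>F x in at_top. v x \<le> v' x"
  shows "\<forall>\<^sub>F x in at_top. half_conv w v x \<le> half_conv w v' x"
proof -
  from assms obtain N where N: "\<And>x. x \<ge> N \<Longrightarrow> v x \<le> v' x"
    by (auto simp: eventually_at_top_linorder)
  show ?thesis
    using eventually_ge_at_top[of "max 0 (2 * N)"]
  proof eventually_elim
    case (elim x)
    have "v (x - y) \<le> v' (x - y)" if "y \<le> x / 2" for y
      using N[of "x - y"] that elim by (simp add: field_simps)
    then show ?case
      unfolding half_conv_def
      by (intro nn_integral_mono) (auto simp: indicator_def intro!: mult_left_mono)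
  qed
qed

section \<open>Half-line convolutions relative to a long-tailed function\<close>

text \<open>
  The following is the squeeze step in the proof of Scheffe's lemma: if a sum converges to the finite
  sum of lower bounds for the two lower limits, then each summand converges to its bound.
\<close>

lemma tendsto_ennreal_summand:
  fixes f g :: "'a \<Rightarrow> ennreal"
  assumes f: "a \<le> Liminf F f" and g: "b \<le> Liminf F g"
    and fg: "((\<lambda>x. f x + g x) \<longlongrightarrow> a + b) F" and fin: "a + b < top"
  shows "(f \<longlongrightarrow> a) F"
proof (rule order_tendstoI)
  fix l assume "l < a"
  with f show "eventually (\<lambda>x. l < f x) F"
    by (intro less_LiminfD) (rule less_le_trans)
next
  fix u assume "a < u"
  then obtain c where c: "a < c" "c < u" using dense by blast
  from fin obtain \<alpha> \<beta> where \<alpha>: "a = ennreal \<alpha>" "0 \<le> \<alpha>" and \<beta>: "b = ennreal \<beta>" "0 \<le> \<beta>"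
    by (cases a; cases b) auto
  from c obtain \<gamma> where \<gamma>: "c = ennreal \<gamma>" "0 \<le> \<gamma>" by (cases c) auto
  define e where "e = (\<gamma> - \<alpha>) / 2"
  have e: "0 < e" "a + ennreal e + ennreal e = c"
    using c \<alpha> \<gamma> by (auto simp: e_def ennreal_less_iff simp flip: ennreal_plus)
  have 1: "eventually (\<lambda>x. b \<le> g x + ennreal e) F"
  proof (cases "\<beta> < e")
    case True
    then have "b \<le> g x + ennreal e" for x
      using \<beta> by (intro order_trans[OF _ add_increasing[of "g x" "ennreal e" "ennreal e"]]) (auto intro: ennreal_leI)
    then show ?thesis by simp
  next
    case False
    then have *: "b = ennreal (\<beta> - e) + ennreal e" and "ennreal (\<beta> - e) < b"
      using \<beta> e by (auto simp: ennreal_less_iff simp flip: ennreal_plus)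
    with g have "eventually (\<lambda>x. ennreal (\<beta> - e) < g x) F"
      by (intro less_LiminfD) (rule less_le_trans)
    then show ?thesis unfolding * by eventually_elim (auto intro: add_right_mono)
  qed
  have "a + b < a + b + ennreal e"
    using \<alpha> \<beta> e by (auto simp: ennreal_less_iff simp flip: ennreal_plus)
  from order_tendstoD(2)[OF fg this] 1
  show "eventually (\<lambda>x. f x < u) F"
  proof eventually_elim
    case (elim x)
    have "b + f x \<le> f x + g x + ennreal e" using elim(2) by (metis add.commute add.left_commute add_left_mono)
    also have "\<dots> \<le> a + b + ennreal e + ennreal e" using elim(1) by (intro add_right_mono) auto
    also have "\<dots> = b + c" using e by (simp add: ac_simps)
    finally have "f x \<le> c" using \<beta> by (simp add: ennreal_add_left_cancel_le)
    with c show ?case by simp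
  qed
qed

lemma half_conv_integrand_tendsto:
  assumes lt: "(\<lambda>x. h (x - y)) \<sim>\<^sub>t h" and X: "filterlim X at_top sequentially"
  shows "(\<lambda>n. w y * (indicator {..X n / 2} y * (h (X n - y) / h (X n)))) \<longlonglongrightarrow> (w y :: ennreal)"
proof -
  have "(\<lambda>n. h (X n - y) / h (X n)) \<longlonglongrightarrow> 1"
    using filterlim_compose[OF lt[unfolded tail_equiv_def] X] .
  moreover have "\<forall>\<^sub>F n in sequentially.
      indicator {..X n / 2} y * (h (X n - y) / h (X n)) = h (X n - y) / h (X n)"
    using filterlim_at_top[THEN iffD1, OF X, rule_format, of "2 * y"]
    by eventually_elim auto
  ultimately have "(\<lambda>n. indicator {..X n / 2} y * (h (X n - y) / h (X n))) \<longlonglongrightarrow> 1"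
    by (simp add: tendsto_cong)
  then have "(\<lambda>n. w y * (indicator {..X n / 2} y * (h (X n - y) / h (X n)))) \<longlonglongrightarrow> w y * 1"
    by (intro tendsto_mult_ennreal) auto
  then show ?thesis by simp
qed

lemma liminf_half_conv_ratio:
  assumes [measurable]: "w \<in> borel_measurable borel" "h \<in> borel_measurable borel"
    and lt: "\<And>y. (\<lambda>x. h (x - y)) \<sim>\<^sub>t h" and X: "filterlim X at_top sequentially"
  shows "(\<integral>\<^sup>+y. w y \<partial>lborel) \<le> liminf (\<lambda>n. half_conv w h (X n) / h (X n))"
proof -
  have "w y \<le> liminf (\<lambda>n. w y * (indicator {..X n / 2} y * (h (X n - y) / h (X n))))" for y
    using lim_imp_Liminf[OF _ half_conv_integrand_tendsto[OF lt[of y] X, of w]] by simp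
  then have "(\<integral>\<^sup>+y. w y \<partial>lborel)
      \<le> (\<integral>\<^sup>+y. liminf (\<lambda>n. w y * (indicator {..X n / 2} y * (h (X n - y) / h (X n)))) \<partial>lborel)"
    by (intro nn_integral_mono)
  also have "\<dots> \<le> liminf (\<lambda>n. half_conv w h (X n) / h (X n))"
    unfolding half_conv_divide[OF assms(1,2)] by (intro nn_integral_liminf) measurable
  finally show ?thesis .
qed

text \<open>
  Fatou's lemma bounds the lower limits for the weights \<open>w\<close> and \<open>c h - w\<close> from below, and the sum of
  the two converges because \<open>[h, h] / h\<close> does; no pointwise bound on \<open>h(x - y) / h(x)\<close> is needed.
\<close>

lemma half_conv_ratio_dominated:
  assumes [measurable]: "w \<in> borel_measurable borel" "h \<in> borel_measurable borel"
    and lt: "\<And>y. (\<lambda>x. h (x - y)) \<sim>\<^sub>t h"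
    and hh: "((\<lambda>x. half_conv h h x / h x) \<longlongrightarrow> (\<integral>\<^sup>+y. h y \<partial>lborel)) at_top"
    and fin: "(\<integral>\<^sup>+y. h y \<partial>lborel) < top"
    and dom: "\<And>y. w y \<le> ennreal c * h y"
  shows "((\<lambda>x. half_conv w h x / h x) \<longlongrightarrow> (\<integral>\<^sup>+y. w y \<partial>lborel)) at_top"
proof (rule tendsto_at_topI_sequentially)
  fix X :: "nat \<Rightarrow> real" assume X: "filterlim X at_top sequentially"
  define u where "u y = ennreal c * h y - w y" for y
  have [measurable]: "u \<in> borel_measurable borel" unfolding u_def by measurable
  have wu: "w y + u y = ennreal c * h y" for y
    using dom by (simp add: u_def)
  have sum: "(\<integral>\<^sup>+y. w y \<partial>lborel) + (\<integral>\<^sup>+y. u y \<partial>lborel) = ennreal c * (\<integral>\<^sup>+y. h y \<partial>lborel)"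
    using wu by (simp flip: nn_integral_add nn_integral_cmult)
  have "half_conv w h x / h x + half_conv u h x / h x = ennreal c * (half_conv h h x / h x)" for x
    using wu by (simp add: ennreal_times_divide flip: half_conv_add half_conv_cmult_left add_divide_distrib_ennreal)
  moreover have "(\<lambda>n. ennreal c * (half_conv h h (X n) / h (X n))) \<longlonglongrightarrow> ennreal c * (\<integral>\<^sup>+y. h y \<partial>lborel)"
    by (intro ennreal_tendsto_cmult filterlim_compose[OF hh X]) simp
  ultimately show "(\<lambda>n. half_conv w h (X n) / h (X n)) \<longlonglongrightarrow> (\<integral>\<^sup>+y. w y \<partial>lborel)"
    using fin sum
    by (intro tendsto_ennreal_summand[OF liminf_half_conv_ratio[OF _ _ lt X] liminf_half_conv_ratio[OF _ _ lt X], where w1=u])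
       (auto simp: ennreal_mult_less_top)
qed

text \<open>
  If \<open>h\<close> is almost decreasing, then for \<open>y \<le> m\<close> the ratio \<open>h(x - y) / h(x)\<close> is at most
  \<open>K h(x - m - 1) / h(x)\<close>, which is eventually below \<open>2 K\<close>, so dominated convergence applies to weights
  supported on \<open>(-\<infinity>, m]\<close>.
\<close>

lemma half_conv_ratio_bounded:
  assumes [measurable]: "w \<in> borel_measurable borel" "h \<in> borel_measurable borel"
    and lt: "\<And>y. (\<lambda>x. h (x - y)) \<sim>\<^sub>t h"
    and fin: "(\<integral>\<^sup>+y. w y \<partial>lborel) < top"
    and supp: "\<And>y. m < y \<Longrightarrow> w y = 0"
    and dec: "\<forall>\<^sub>F x in at_top. \<forall>y>0. h (x + y) \<le> ennreal K * h x"
  shows "((\<lambda>x. half_conv w h x / h x) \<longlongrightarrow> (\<integral>\<^sup>+y. w y \<partial>lborel)) at_top"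
proof (rule tendsto_at_topI_sequentially)
  fix X :: "nat \<Rightarrow> real" assume X: "filterlim X at_top sequentially"
  define s where "s x y = indicator {..x / 2} y * (h (x - y) / h x)" for x y
  have [measurable]: "s x \<in> borel_measurable borel" for x unfolding s_def by measurable
  \<comment> \<open>The shift by \<open>m + 1\<close> makes the increment \<open>m + 1 - y\<close> strictly positive also for \<open>y = m\<close>.\<close>
  let ?m = "m + 1"
  have lim: "(\<lambda>n. w y * s (X n) y) \<longlonglongrightarrow> w y" for y
    unfolding s_def by (rule half_conv_integrand_tendsto[OF lt X])
  have "\<forall>\<^sub>F x in at_top. \<forall>y\<le>m. s x y \<le> ennreal (2 * K)"
    using eventually_compose_filterlim[OF dec filterlim_minus_const_at_top[of ?m]]
      order_tendstoD(2)[OF lt[unfolded tail_equiv_def, of ?m], of 2, simplified]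
  proof eventually_elim
    case (elim x)
    have "h (x - y) / h x \<le> ennreal (2 * K)" if "y \<le> m" for y
    proof -
      have "h (x - y) \<le> ennreal K * h (x - ?m)"
        using elim(1)[rule_format, of "?m - y"] that by (simp add: algebra_simps)
      then have "h (x - y) / h x \<le> ennreal K * (h (x - ?m) / h x)"
        by (simp add: ennreal_times_divide divide_right_mono_ennreal)
      also have "\<dots> \<le> ennreal K * 2" using elim(2) by (intro mult_left_mono) auto
      also have "\<dots> = ennreal (2 * K)" by (simp add: ennreal_mult'' mult.commute)
      finally show ?thesis .
    qed
    then show ?case by (auto simp: s_def indicator_def)
  qed
  then have "\<forall>\<^sub>F n in sequentially. \<forall>y\<le>m. s (X n) y \<le> ennreal (2 * K)"
    using X by (rule eventually_compose_filterlim)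
  then obtain N where N: "\<And>n y. n \<ge> N \<Longrightarrow> y \<le> m \<Longrightarrow> s (X n) y \<le> ennreal (2 * K)"
    by (auto simp: eventually_sequentially)
  have "(\<lambda>n. \<integral>\<^sup>+y. w y * s (X (n + N)) y \<partial>lborel) \<longlonglongrightarrow> (\<integral>\<^sup>+y. w y \<partial>lborel)"
  proof (rule nn_integral_dominated_convergence[where w="\<lambda>y. w y * ennreal (2 * K)"])
    show "AE y in lborel. w y * s (X (n + N)) y \<le> w y * ennreal (2 * K)" for n
    proof (intro AE_I2)
      fix y show "w y * s (X (n + N)) y \<le> w y * ennreal (2 * K)"
        using N[of "n + N" y] supp[of y] by (cases "y \<le> m") (auto intro: mult_left_mono)
    qed
    show "AE y in lborel. (\<lambda>n. w y * s (X (n + N)) y) \<longlonglongrightarrow> w y"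
      using lim LIMSEQ_ignore_initial_segment[of "\<lambda>n. w _ * s (X n) _" _ N] by auto
  qed (use fin in \<open>auto simp: nn_integral_multc ennreal_mult_less_top\<close>)
  then have "(\<lambda>n. \<integral>\<^sup>+y. w y * s (X n) y \<partial>lborel) \<longlonglongrightarrow> (\<integral>\<^sup>+y. w y \<partial>lborel)"
    by (rule LIMSEQ_offset)
  then show "(\<lambda>n. half_conv w h (X n) / h (X n)) \<longlonglongrightarrow> (\<integral>\<^sup>+y. w y \<partial>lborel)"
    by (simp add: half_conv_divide s_def)
qed

text \<open>
  The weight is split at a point beyond which \<open>w \<le> h\<close>: the right part is dominated by \<open>h\<close>, and the left
  part is supported on a half-line \<open>(-\<infinity>, N]\<close>.
\<close>

lemma half_conv_ratio_al_decreasing: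
  assumes [measurable]: "w \<in> borel_measurable borel" "h \<in> borel_measurable borel"
    and lt: "\<And>y. (\<lambda>x. h (x - y)) \<sim>\<^sub>t h"
    and hh: "((\<lambda>x. half_conv h h x / h x) \<longlongrightarrow> (\<integral>\<^sup>+y. h y \<partial>lborel)) at_top"
    and fin: "(\<integral>\<^sup>+y. h y \<partial>lborel) < top" "(\<integral>\<^sup>+y. w y \<partial>lborel) < top"
    and dom: "\<forall>\<^sub>F y in at_top. w y \<le> h y"
    and dec: "\<forall>\<^sub>F x in at_top. \<forall>y>0. h (x + y) \<le> ennreal K * h x"
  shows "((\<lambda>x. half_conv w h x / h x) \<longlongrightarrow> (\<integral>\<^sup>+y. w y \<partial>lborel)) at_top"
proof -
  from dom obtain N where N: "\<And>y. y > N \<Longrightarrow> w y \<le> h y"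
    by (auto simp: eventually_at_top_dense)
  define w1 where "w1 y = w y * indicator {..N} y" for y
  define w2 where "w2 y = w y * indicator {N<..} y" for y
  have [measurable]: "w1 \<in> borel_measurable borel" "w2 \<in> borel_measurable borel"
    unfolding w1_def w2_def by measurable
  have w: "w = (\<lambda>y. w1 y + w2 y)" by (auto simp: w1_def w2_def indicator_def)
  have "(\<integral>\<^sup>+y. w1 y \<partial>lborel) \<le> (\<integral>\<^sup>+y. w y \<partial>lborel)"
    by (intro nn_integral_mono) (auto simp: w1_def indicator_def)
  also note fin(2)
  finally have "((\<lambda>x. half_conv w1 h x / h x) \<longlongrightarrow> (\<integral>\<^sup>+y. w1 y \<partial>lborel)) at_top"
    using dec by (intro half_conv_ratio_bounded[OF _ _ lt, where m=N]) (auto simp: w1_def)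
  moreover have "((\<lambda>x. half_conv w2 h x / h x) \<longlongrightarrow> (\<integral>\<^sup>+y. w2 y \<partial>lborel)) at_top"
    using N by (intro half_conv_ratio_dominated[OF _ _ lt hh fin(1), where c=1]) (auto simp: w2_def indicator_def)
  ultimately have "((\<lambda>x. half_conv w1 h x / h x + half_conv w2 h x / h x) \<longlongrightarrow>
      (\<integral>\<^sup>+y. w1 y \<partial>lborel) + (\<integral>\<^sup>+y. w2 y \<partial>lborel)) at_top"
    by (rule tendsto_add)
  then show ?thesis
    unfolding w by (simp add: half_conv_add nn_integral_add add_divide_distrib_ennreal)
qed

text \<open>
  On the range of \<open>x - y\<close> seen by the half-line convolution, \<open>v\<close> lies between \<open>(c - e) h\<close> and
  \<open>(c + e) h\<close> as soon as \<open>x\<close> is large. The case \<open>c = 0\<close> covers \<open>v = o(h)\<close>.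
\<close>

lemma half_conv_ratio_transfer:
  assumes [measurable]: "w \<in> borel_measurable borel" "v \<in> borel_measurable borel"
      "h \<in> borel_measurable borel"
    and pos: "\<forall>\<^sub>F x in at_top. 0 < h x \<and> h x < top"
    and vh: "((\<lambda>x. v x / h x) \<longlongrightarrow> ennreal c) at_top"
    and wh: "((\<lambda>x. half_conv w h x / h x) \<longlongrightarrow> ennreal m) at_top"
    and c: "0 \<le> c" and m: "0 \<le> m"
  shows "((\<lambda>x. half_conv w v x / h x) \<longlongrightarrow> ennreal c * ennreal m) at_top"
proof (rule order_tendstoI)
  fix u assume u: "ennreal c * ennreal m < u"
  have "((\<lambda>e. ennreal (c + e) * ennreal m) \<longlongrightarrow> ennreal (c + 0) * ennreal m) (at_right 0)"
    by (intro tendsto_mult_ennreal tendsto_intros) auto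
  then have "\<forall>\<^sub>F e in at_right 0. 0 < e \<and> ennreal (c + e) * ennreal m < u"
    using u by (intro eventually_conj eventually_at_right_less order_tendstoD) auto
  then obtain e where e: "e > 0" "ennreal (c + e) * ennreal m < u"
    by (auto dest!: eventually_happens'[OF trivial_limit_at_right_real])
  have "\<forall>\<^sub>F x in at_top. v x / h x < ennreal (c + e)"
    using e c by (intro order_tendstoD(2)[OF vh]) (auto simp: ennreal_less_iff)
  then have "\<forall>\<^sub>F x in at_top. v x \<le> ennreal (c + e) * h x"
    using pos by eventually_elim (auto simp: divide_less_ennreal)
  then have "\<forall>\<^sub>F x in at_top. half_conv w v x \<le> half_conv w (\<lambda>x. ennreal (c + e) * h x) x"
    by (rule eventually_half_conv_mono)
  moreover have "((\<lambda>x. ennreal (c + e) * (half_conv w h x / h x)) \<longlongrightarrow> ennreal (c + e) * ennreal m) at_top"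
    using wh by (intro ennreal_tendsto_cmult) auto
  then have "\<forall>\<^sub>F x in at_top. ennreal (c + e) * (half_conv w h x / h x) < u"
    using e by (intro order_tendstoD)
  ultimately show "\<forall>\<^sub>F x in at_top. half_conv w v x / h x < u"
    by eventually_elim
       (auto simp: half_conv_cmult_right ennreal_times_divide intro: le_less_trans[OF divide_right_mono_ennreal])
next
  fix l assume l: "l < ennreal c * ennreal m"
  then have "c \<noteq> 0" by auto
  with c have c: "0 < c" by simp
  have "((\<lambda>e. ennreal (c - e) * ennreal m) \<longlongrightarrow> ennreal (c - 0) * ennreal m) (at_right 0)"
    by (intro tendsto_mult_ennreal tendsto_intros) auto
  then have "\<forall>\<^sub>F e in at_right 0. 0 < e \<and> l < ennreal (c - e) * ennreal m"
    using l by (intro eventually_conj eventually_at_right_less order_tendstoD) auto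
  then obtain e where e: "e > 0" "l < ennreal (c - e) * ennreal m"
    by (auto dest!: eventually_happens'[OF trivial_limit_at_right_real])
  have "\<forall>\<^sub>F x in at_top. ennreal (c - e) < v x / h x"
    using e c by (intro order_tendstoD(1)[OF vh]) (auto simp: ennreal_lessI)
  then have "\<forall>\<^sub>F x in at_top. ennreal (c - e) * h x \<le> v x"
    using pos by eventually_elim (metis divide_less_ennreal less_irrefl linorder_not_less order_le_less not_gr_zero)
  then have "\<forall>\<^sub>F x in at_top. half_conv w (\<lambda>x. ennreal (c - e) * h x) x \<le> half_conv w v x"
    by (rule eventually_half_conv_mono)
  moreover have "((\<lambda>x. ennreal (c - e) * (half_conv w h x / h x)) \<longlongrightarrow> ennreal (c - e) * ennreal m) at_top"
    using wh by (intro ennreal_tendsto_cmult) auto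
  then have "\<forall>\<^sub>F x in at_top. l < ennreal (c - e) * (half_conv w h x / h x)"
    using e by (intro order_tendstoD)
  ultimately show "\<forall>\<^sub>F x in at_top. l < half_conv w v x / h x"
    by eventually_elim
       (auto simp: half_conv_cmult_right ennreal_times_divide intro: less_le_trans[OF _ divide_right_mono_ennreal])
qed

section \<open>Subexponentiality in terms of half-line convolutions\<close>

lemma gen_density_mass:
  assumes "gen_density k"
  obtains c where "0 \<le> c" "c \<le> 1" "atom k = ennreal c"
    "(\<integral>\<^sup>+x. acpart k x \<partial>lborel) = ennreal (1 - c)"
proof -
  obtain p f where p: "0 \<le> p" "p \<le> 1" and f: "f \<in> borel_measurable borel"
    "(\<integral>\<^sup>+x. f x \<partial>lborel) = 1" and k: "k = mix p f"
    using assms unfolding gen_density_def prob_density_def by auto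
  then show thesis by (intro that[of p]) (auto simp: mix_def nn_integral_cmult)
qed

text \<open>
  With \<open>c\<close> the atom, \<open>k * k\<close> has the tail \<open>2 c k + 2 [k, k]\<close>, and \<open>1 - c\<close> is the mass of the absolutely
  continuous part.
\<close>

lemma subexponential_iff_half_conv:
  assumes k: "gen_density k" and lt: "long_tailed k"
  shows "subexponential k \<longleftrightarrow>
    ((\<lambda>x. half_conv (acpart k) (acpart k) x / acpart k x) \<longlongrightarrow> (\<integral>\<^sup>+y. acpart k y \<partial>lborel)) at_top"
proof -
  obtain c where c: "0 \<le> c" "c \<le> 1" "atom k = ennreal c"
    "(\<integral>\<^sup>+x. acpart k x \<partial>lborel) = ennreal (1 - c)"
    using gen_density_mass[OF k] .
  let ?h = "acpart k"
  note [measurable] = gen_density_gmeasure(1)[OF k]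
  have pos: "\<forall>\<^sub>F x in at_top. 0 < ?h x \<and> ?h x < top"
    using lt tail_equiv_eventually_finite[of "\<lambda>x. ?h (x + 1)" ?h]
    by (auto simp: long_tailed_def elim: eventually_mono)
  have eq: "acpart (k \<star>\<^sub>g k) x / (2 * ?h x) = ennreal c + half_conv ?h ?h x / ?h x"
    if "0 < ?h x" "?h x < top" for x
  proof -
    have "acpart (k \<star>\<^sub>g k) x = (ennreal c * ?h x + half_conv ?h ?h x) * 2"
      using convolution_eq_half_conv[of ?h ?h x]
      by (simp add: gconv_def c distrib_right mult_2_right)
    then have "acpart (k \<star>\<^sub>g k) x / (2 * ?h x) = (ennreal c * ?h x + half_conv ?h ?h x) * 2 / (?h x * 2)"
      by (simp only: mult.commute[of 2])
    also have "\<dots> = (ennreal c * ?h x + half_conv ?h ?h x) / ?h x"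
      by (rule divide_mult_eq) auto
    finally show ?thesis using that by (simp add: add_divide_distrib_ennreal mult_divide_eq_ennreal)
  qed
  have "subexponential k \<longleftrightarrow>
      ((\<lambda>x. ennreal c + half_conv ?h ?h x / ?h x) \<longlongrightarrow> ennreal c + ennreal (1 - c)) at_top"
    unfolding subexponential_def tail_equiv_def
    using lt c eventually_mono[OF pos, of "\<lambda>x. acpart (k \<star>\<^sub>g k) x / (2 * ?h x) = ennreal c + half_conv ?h ?h x / ?h x"] eq
    by (simp add: tendsto_cong flip: ennreal_plus)
  also have "\<dots> \<longleftrightarrow> ((\<lambda>x. half_conv ?h ?h x / ?h x) \<longlongrightarrow> ennreal (1 - c)) at_top"
  proof
    assume "((\<lambda>x. ennreal c + half_conv ?h ?h x / ?h x) \<longlongrightarrow> ennreal c + ennreal (1 - c)) at_top"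
    then have "((\<lambda>x. ennreal c + half_conv ?h ?h x / ?h x - ennreal c) \<longlongrightarrow>
        ennreal c + ennreal (1 - c) - ennreal c) at_top"
      by (intro tendsto_diff_ennreal_general tendsto_const) auto
    then show "((\<lambda>x. half_conv ?h ?h x / ?h x) \<longlongrightarrow> ennreal (1 - c)) at_top" by simp
  qed (intro tendsto_add tendsto_const)
  finally show ?thesis by (simp add: c)
qed

section \<open>Inverting the convolution equation\<close>

text \<open>
  Here \<open>j\<close> stands for an average of \<open>\<beta>\<close> with weights of total mass \<open>i\<close>; the equation
  improves an eventual bound \<open>d > 0\<close> for \<open>\<bar>\<beta> - 1\<bar>\<close> to \<open>r d\<close>, for any fixed \<open>r > q / p\<close>.
\<close>

lemma tendsto_one_by_contraction:
  fixes \<beta> e i j :: "'a \<Rightarrow> real" and p q :: real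
  assumes pq: "0 \<le> q" "q < p" "p + q = 1"
    and eq: "\<forall>\<^sub>F x in F. p * \<beta> x + e x + j x = 1"
    and e: "(e \<longlongrightarrow> 0) F" and i: "(i \<longlongrightarrow> q) F"
    and ji: "\<And>d. 0 \<le> d \<Longrightarrow> \<forall>\<^sub>F x in F. \<bar>\<beta> x - 1\<bar> \<le> d \<Longrightarrow> \<forall>\<^sub>F x in F. \<bar>j x - i x\<bar> \<le> d * i x"
    and bound: "\<forall>\<^sub>F x in F. \<bar>\<beta> x - 1\<bar> \<le> d\<^sub>0"
  shows "(\<beta> \<longlongrightarrow> 1) F"
proof -
  \<comment> \<open>Any \<open>r\<close> strictly between \<open>q / p\<close> and \<open>1\<close> works; the gap to \<open>q / p\<close> absorbs the \<open>o(1)\<close> terms.\<close>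
  define r where "r = (1 + q / p) / 2"
  have p: "0 < p" and r: "0 \<le> r" "r < 1" "q < p * r"
    using pq by (auto simp: r_def field_simps)
  have step: "\<forall>\<^sub>F x in F. \<bar>\<beta> x - 1\<bar> \<le> r * d" if d: "0 < d" "\<forall>\<^sub>F x in F. \<bar>\<beta> x - 1\<bar> \<le> d" for d
  proof -
    have "((\<lambda>x. \<bar>e x\<bar> + \<bar>i x - q\<bar> + d * i x) \<longlongrightarrow> \<bar>0\<bar> + \<bar>q - q\<bar> + d * q) F"
      by (intro tendsto_intros e i)
    moreover have "d * q < p * r * d" using d r by simp
    ultimately have "\<forall>\<^sub>F x in F. \<bar>e x\<bar> + \<bar>i x - q\<bar> + d * i x < p * r * d"
      by (intro order_tendstoD) auto
    with eq ji[OF less_imp_le[OF d(1)] d(2)] show ?thesis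
    proof eventually_elim
      case (elim x)
      have "p * (\<beta> x - 1) = - e x - (j x - i x) - (i x - q)"
        using elim(1) pq by (simp add: algebra_simps)
      then have "\<bar>p * (\<beta> x - 1)\<bar> \<le> p * (r * d)" using elim by linarith
      then show ?case using p by (simp add: abs_mult)
    qed
  qed
  define D where "D = max d\<^sub>0 1"
  have D: "0 < D" by (simp add: D_def)
  have it: "\<forall>\<^sub>F x in F. \<bar>\<beta> x - 1\<bar> \<le> r ^ n * D" for n
  proof (induction n)
    case 0
    from bound show ?case by eventually_elim (simp add: D_def)
  next
    case (Suc n)
    have "0 < r" using pq p by (auto simp: r_def intro!: divide_pos_pos add_pos_nonneg)
    with step[OF _ Suc] D show ?case by (simp add: mult.assoc)
  qed
  show ?thesis
  proof (rule tendstoI)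
    fix \<epsilon> :: real assume "0 < \<epsilon>"
    have "(\<lambda>n. r ^ n * D) \<longlonglongrightarrow> 0 * D"
      using r by (intro tendsto_intros LIMSEQ_realpow_zero) auto
    then have "\<forall>\<^sub>F n in sequentially. r ^ n * D < \<epsilon>"
      using \<open>0 < \<epsilon>\<close> by (intro order_tendstoD) auto
    then obtain n where "r ^ n * D < \<epsilon>" by (auto simp: eventually_sequentially)
    with it[of n] show "\<forall>\<^sub>F x in F. dist (\<beta> x) 1 < \<epsilon>"
      by (auto elim!: eventually_mono simp: dist_real_def)
  qed
qed

text \<open>
  The equation determines the tail of \<open>b\<close> from that of \<open>h\<close> because the defective weight \<open>a\<close> has mass
  \<open>q < p\<close>. This is where an atom larger than one half is used.
\<close>

lemma tail_equiv_of_renewal_equation: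
  fixes a b e h :: "real \<Rightarrow> ennreal" and p q :: real
  assumes [measurable]: "a \<in> borel_measurable borel" "b \<in> borel_measurable borel"
      "h \<in> borel_measurable borel"
    and pq: "0 \<le> q" "q < p" "p + q = 1"
    and h: "\<And>x. h x = ennreal p * b x + e x + half_conv a b x"
    and pos: "\<forall>\<^sub>F x in at_top. 0 < h x \<and> h x < top"
    and e: "((\<lambda>x. e x / h x) \<longlongrightarrow> 0) at_top"
    and ah: "((\<lambda>x. half_conv a h x / h x) \<longlongrightarrow> ennreal q) at_top"
  shows "b \<sim>\<^sub>t h"
proof -
  define \<beta> where "\<beta> x = enn2real (b x / h x)" for x
  define \<epsilon> where "\<epsilon> x = enn2real (e x / h x)" for x
  define I where "I x = enn2real (half_conv a h x / h x)" for x
  define J where "J x = enn2real (half_conv a b x / h x)" for x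
  have nonneg: "0 \<le> \<beta> x" "0 \<le> \<epsilon> x" "0 \<le> J x" for x
    by (simp_all add: \<beta>_def \<epsilon>_def J_def)
  have p: "0 < p" using pq by simp
  have ratios: "\<forall>\<^sub>F x in at_top. b x / h x = ennreal (\<beta> x) \<and> e x / h x = ennreal (\<epsilon> x)
      \<and> half_conv a b x / h x = ennreal (J x)
      \<and> ennreal p * (b x / h x) + e x / h x + half_conv a b x / h x = 1"
    using pos
  proof eventually_elim
    case (elim x)
    then have "h x / h x = 1" by (intro ennreal_divide_self) auto
    then have sum: "ennreal p * (b x / h x) + e x / h x + half_conv a b x / h x = 1"
      unfolding h[of x] by (simp add: add_divide_distrib_ennreal ennreal_times_divide)
    then have "ennreal p * (b x / h x) < top" "e x / h x < top" "half_conv a b x / h x < top"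
      by (metis ennreal_add_eq_top ennreal_one_neq_top less_top)+
    with sum p show ?case
      by (auto simp: \<beta>_def \<epsilon>_def J_def ennreal_mult_less_top)
  qed
  have Ifin: "\<forall>\<^sub>F x in at_top. half_conv a h x / h x = ennreal (I x)"
    using order_tendstoD(2)[OF ah, of top] by (auto simp: I_def elim: eventually_mono)
  have eqn: "\<forall>\<^sub>F x in at_top. p * \<beta> x + \<epsilon> x + J x = 1"
    using ratios
  proof eventually_elim
    case (elim x)
    then have "ennreal p * ennreal (\<beta> x) + ennreal (\<epsilon> x) + ennreal (J x) = 1"
      by metis
    then have "ennreal (p * \<beta> x + \<epsilon> x + J x) = ennreal 1"
      using p nonneg by (simp add: ennreal_mult)
    then show ?case using p nonneg by (subst (asm) ennreal_inj) auto
  qed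
  have "(\<beta> \<longlongrightarrow> 1) at_top"
  proof (rule tendsto_one_by_contraction[OF pq eqn])
    show "(\<epsilon> \<longlongrightarrow> 0) at_top"
      unfolding \<epsilon>_def using tendsto_enn2real[OF e[folded ennreal_0]] by simp
    show "(I \<longlongrightarrow> q) at_top"
      unfolding I_def using tendsto_enn2real[OF ah] pq by simp
    \<comment> \<open>Start of the iteration: \<open>0 \<le> \<beta> \<le> 1 / p\<close> because \<open>p b \<le> h\<close>.\<close>
    show "\<forall>\<^sub>F x in at_top. \<bar>\<beta> x - 1\<bar> \<le> 1 / p"
      using eqn
    proof eventually_elim
      case (elim x)
      have "p * \<beta> x \<le> 1" "0 \<le> \<beta> x" using elim nonneg[of x] by auto
      moreover have "1 \<le> 1 / p" using pq p by simp
      moreover have "\<beta> x \<le> 1 / p" using \<open>p * \<beta> x \<le> 1\<close> p by (simp add: field_simps)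
      ultimately show ?case by linarith
    qed
    fix d assume d: "0 \<le> d" "\<forall>\<^sub>F x in at_top. \<bar>\<beta> x - 1\<bar> \<le> d"
    have "\<forall>\<^sub>F x in at_top. b x \<le> ennreal (1 + d) * h x \<and> ennreal (1 - d) * h x \<le> b x"
      using d(2) ratios pos
    proof eventually_elim
      case (elim x)
      then have "b x = ennreal (\<beta> x) * h x"
        by (metis ennreal_divide_times ennreal_divide_self less_irrefl mult.right_neutral)
      moreover have "1 - d \<le> \<beta> x" "\<beta> x \<le> 1 + d" using elim(1) by linarith+
      ultimately show ?case
        by (simp only:) (intro conjI mult_right_mono ennreal_leI zero_le)
    qed
    then have "\<forall>\<^sub>F x in at_top. half_conv a b x \<le> half_conv a (\<lambda>x. ennreal (1 + d) * h x) x"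
        "\<forall>\<^sub>F x in at_top. half_conv a (\<lambda>x. ennreal (1 - d) * h x) x \<le> half_conv a b x"
      by (auto intro!: eventually_half_conv_mono elim: eventually_mono)
    then show "\<forall>\<^sub>F x in at_top. \<bar>J x - I x\<bar> \<le> d * I x"
      using ratios Ifin
    proof eventually_elim
      case (elim x)
      have I: "0 \<le> I x" "0 \<le> J x" by (auto simp: I_def J_def)
      have "ennreal (J x) \<le> ennreal (1 + d) * ennreal (I x)"
        using divide_right_mono_ennreal[OF elim(1), of "h x"] elim(3,4)
        by (simp add: half_conv_cmult_right flip: ennreal_times_divide)
      then have 1: "J x \<le> (1 + d) * I x"
        using d I by (simp flip: ennreal_mult del: ennreal_plus)
      have "ennreal (1 - d) * ennreal (I x) \<le> ennreal (J x)"
        using divide_right_mono_ennreal[OF elim(2), of "h x"] elim(3,4)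
        by (simp add: half_conv_cmult_right flip: ennreal_times_divide)
      then have 2: "(1 - d) * I x \<le> J x"
        using I by (simp flip: ennreal_mult'')
      from 1 2 show ?case by (simp add: algebra_simps abs_le_iff)
    qed
  qed
  then have "((\<lambda>x. ennreal (\<beta> x)) \<longlongrightarrow> ennreal 1) at_top" by (rule tendsto_ennrealI)
  moreover have "\<forall>\<^sub>F x in at_top. b x / h x = ennreal (\<beta> x)"
    using ratios by (auto elim: eventually_mono)
  ultimately show ?thesis by (simp add: tail_equiv_def tendsto_cong)
qed

section \<open>Subexponentiality of the second factor\<close>

theorem proposition4p2:
  fixes F G H :: gdens and p\<^sub>g :: real and g :: "real \<Rightarrow> ennreal"
  assumes F: "gen_density F"
    and p\<^sub>g: "1 / 2 < p\<^sub>g" "p\<^sub>g < 1"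
    and g: "prob_density g"
    and G: "G = mix p\<^sub>g g"
    and H: "H = G \<star>\<^sub>g F"
    and sub: "subexponential H"
    and alt: "almost_decreasing H \<or>
      (\<exists>p\<^sub>f f. 0 < p\<^sub>f \<and> p\<^sub>f < 1 \<and> prob_density f \<and> F = mix p\<^sub>f f)"
    and small: "tail_smallo (acpart G) (acpart H)"
  shows "subexponential F \<and> acpart H \<sim>\<^sub>t acpart F"
proof -
  define a b h where "a = acpart G" and "b = acpart F" and "h = acpart H"
  define q where "q = 1 - p\<^sub>g"
  have gG: "gen_density G" unfolding gen_density_def
    by (intro exI[of _ p\<^sub>g] exI[of _ g]) (use p\<^sub>g g G in auto)
  have gH: "gen_density H" unfolding H by (rule gen_density_gconv[OF gG F])
  have [measurable]: "a \<in> borel_measurable borel" "b \<in> borel_measurable borel" "h \<in> borel_measurable borel"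
    using gen_density_gmeasure(1) gG F gH by (auto simp: a_def b_def h_def)
  obtain c where c: "0 \<le> c" "c \<le> 1" "atom F = ennreal c" "(\<integral>\<^sup>+x. b x \<partial>lborel) = ennreal (1 - c)"
    using gen_density_mass[OF F] unfolding b_def .
  obtain c' where "(\<integral>\<^sup>+x. h x \<partial>lborel) = ennreal (1 - c')"
    using gen_density_mass[OF gH] unfolding h_def .
  then have hfin: "(\<integral>\<^sup>+x. h x \<partial>lborel) < top" by simp
  have aint: "(\<integral>\<^sup>+x. a x \<partial>lborel) = ennreal q"
    using g by (simp add: a_def G mix_def q_def prob_density_def nn_integral_cmult)
  have eq: "h x = ennreal p\<^sub>g * b x + ennreal c * a x + (half_conv b a x + half_conv a b x)" for x
  proof -
    have "h x = atom G * b x + atom F * a x + (\<integral>\<^sup>+y. a (x - y) * b y \<partial>lborel)"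
      by (simp add: h_def H gconv_def a_def b_def)
    also have "(\<integral>\<^sup>+y. a (x - y) * b y \<partial>lborel) = half_conv b a x + half_conv a b x"
      by (rule convolution_eq_half_conv) measurable
    finally show ?thesis by (simp add: G mix_def c)
  qed
  have lt: "long_tailed H" using sub by (simp add: subexponential_def)
  have shift: "(\<lambda>x. h (x - y)) \<sim>\<^sub>t h" for y
    by (rule tail_equiv_shift) (use lt in \<open>simp add: long_tailed_def h_def\<close>)
  have pos: "\<forall>\<^sub>F x in at_top. 0 < h x \<and> h x < top"
    using tail_equiv_eventually_finite[OF shift[of 0]] by (auto elim: eventually_mono)
  have hh: "((\<lambda>x. half_conv h h x / h x) \<longlongrightarrow> (\<integral>\<^sup>+y. h y \<partial>lborel)) at_top"
    using subexponential_iff_half_conv[OF gH lt] sub by (simp add: h_def)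
  have ah0: "((\<lambda>x. a x / h x) \<longlongrightarrow> ennreal 0) at_top"
    using small by (simp add: tail_smallo_def a_def h_def)
  have dominated: "w y \<le> ennreal (1 / r) * h y" if "0 < r" "ennreal r * w y \<le> h y" for w r and y :: real
  proof -
    have "w y = ennreal (1 / r) * (ennreal r * w y)"
      using that by (simp flip: ennreal_mult mult.assoc)
    also have "\<dots> \<le> ennreal (1 / r) * h y" using that by (intro mult_left_mono) auto
    finally show ?thesis .
  qed
  have bh: "((\<lambda>x. half_conv b h x / h x) \<longlongrightarrow> ennreal (1 - c)) at_top"
  proof -
    have "ennreal p\<^sub>g * b y \<le> h y" for y
      unfolding eq by (simp add: add.assoc)
    then show ?thesis
      unfolding c(4)[symmetric] using p\<^sub>g
      by (intro half_conv_ratio_dominated[OF _ _ shift hh hfin dominated[of p\<^sub>g]]) auto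
  qed
  have ah: "((\<lambda>x. half_conv a h x / h x) \<longlongrightarrow> ennreal q) at_top"
    unfolding aint[symmetric] using alt
  proof
    assume "almost_decreasing H"
    then obtain x\<^sub>0 K where K: "0 < K" "\<And>x y. x > x\<^sub>0 \<Longrightarrow> y > 0 \<Longrightarrow> h (x + y) \<le> ennreal K * h x"
      unfolding almost_decreasing_def h_def by blast
    have dec: "\<forall>\<^sub>F x in at_top. \<forall>y>0. h (x + y) \<le> ennreal K * h x"
      using eventually_gt_at_top[of x\<^sub>0] by (rule eventually_mono) (use K(2) in blast)
    have "\<forall>\<^sub>F x in at_top. a x / h x < 1"
      by (rule order_tendstoD[OF ah0]) simp
    then have "\<forall>\<^sub>F x in at_top. a x \<le> h x"
      using pos by eventually_elim (auto simp: divide_less_ennreal)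
    then show "((\<lambda>x. half_conv a h x / h x) \<longlongrightarrow> (\<integral>\<^sup>+y. a y \<partial>lborel)) at_top"
      using dec hfin aint by (intro half_conv_ratio_al_decreasing[OF _ _ shift hh]) auto
  next
    assume "\<exists>p\<^sub>f f. 0 < p\<^sub>f \<and> p\<^sub>f < 1 \<and> prob_density f \<and> F = mix p\<^sub>f f"
    then have "0 < c" using c by (auto simp: mix_def)
    moreover have "ennreal c * a y \<le> h y" for y
      unfolding eq by (intro order_trans[OF _ add_increasing2[OF _ order_refl]] add_increasing) auto
    ultimately show "((\<lambda>x. half_conv a h x / h x) \<longlongrightarrow> (\<integral>\<^sup>+y. a y \<partial>lborel)) at_top"
      by (intro half_conv_ratio_dominated[OF _ _ shift hh hfin dominated[of c]]) auto
  qed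
  have "((\<lambda>x. half_conv b a x / h x) \<longlongrightarrow> ennreal 0 * ennreal (1 - c)) at_top"
    using c by (intro half_conv_ratio_transfer[OF _ _ _ pos ah0 bh]) auto
  moreover have "((\<lambda>x. ennreal c * (a x / h x)) \<longlongrightarrow> ennreal c * ennreal 0) at_top"
    using ah0 by (intro ennreal_tendsto_cmult) auto
  ultimately have "((\<lambda>x. ennreal c * (a x / h x) + half_conv b a x / h x) \<longlongrightarrow>
      ennreal c * ennreal 0 + ennreal 0 * ennreal (1 - c)) at_top"
    by (intro tendsto_add)
  then have "((\<lambda>x. (ennreal c * a x + half_conv b a x) / h x) \<longlongrightarrow> 0) at_top"
    by (simp add: add_divide_distrib_ennreal ennreal_times_divide)
  then have bh1: "b \<sim>\<^sub>t h"
    using p\<^sub>g by (intro tail_equiv_of_renewal_equation[OF _ _ _ _ _ _ _ pos _ ah, where p=p\<^sub>g])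
      (auto simp: q_def eq add.assoc)
  then have ltF: "long_tailed F" by (intro long_tailed_tail_equiv[OF lt]) (simp add: b_def h_def)
  have "((\<lambda>x. half_conv b b x / h x) \<longlongrightarrow> ennreal 1 * ennreal (1 - c)) at_top"
    using c bh1 by (intro half_conv_ratio_transfer[OF _ _ _ pos _ bh]) (auto simp: tail_equiv_def)
  then have "((\<lambda>x. half_conv b b x / b x) \<longlongrightarrow> ennreal 1 * ennreal (1 - c)) at_top"
    by (rule tail_ratio_trans[OF _ tail_equiv_sym[OF bh1]])
  then have "subexponential F"
    using subexponential_iff_half_conv[OF F ltF] c by (simp add: b_def)
  with tail_equiv_sym[OF bh1] show ?thesis by (simp add: b_def h_def)
qed

end
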